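(* Let $A$ be a non-finite set, let $Z$ be a subset of $P(A)$ with $|Z| = |A|$, and let $f : A \rightarrow Z$ be a bijection between $A$ and $Z$. Then $Z$ is a proper subset of $P(A)$.
   Context: $P(A)$ denotes the power set of $A$, i.e. the set of all subsets of $A$, and $|X|$ denotes the cardinality of a set $X$. *)

theory Defs imports Main begin

unbundle cardinal_syntax

end

theory Submission imports Defs begin

theorem theorem1:
  fixes A :: "'a set" and Z :: "'a set set" and f :: "'a \<Rightarrow> 'a set"
  assumes "infinite A"
    and "Z \<subseteq> Pow A"
    and "|Z| =o |A|"
    and "bij_betw f A Z"
  shows "Z \<subset> Pow A"
proof -
  \<comment> \<open>Cantor's diagonal set: it disagrees with each \<open>f a\<close> about whether \<open>a\<close> is an element,
    so it lies in the power set but outside the image of \<open>f\<close>.\<close>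
  define D where "D = {a \<in> A. a \<notin> f a}"
  have "D \<in> Pow A"
    by (auto simp: D_def)
  moreover have "D \<notin> f ` A"
  proof
    assume "D \<in> f ` A"
    then obtain a where "a \<in> A" "D = f a"
      by blast
    moreover have "a \<in> D \<longleftrightarrow> a \<in> A \<and> a \<notin> f a"
      unfolding D_def by blast
    ultimately show False
      by blast
  qed
  then have "D \<notin> Z"
    using assms(4) by (simp add: bij_betw_imp_surj_on)
  ultimately show ?thesis
    using assms(2) by blast
qed

end
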